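(* For $k,m,n\ge 0$, let $f_{k,m,n}$ be the number of $k$-dimensional faces of the arrangement $\mathcal{A}_{m,n}$ in $\mathbb{R}^{m+n}$. Then, as formal power series, $$\sum_{k,m,n\ge 0} f_{k,m,n}\,t^k\,\frac{x^m}{m!}\,\frac{y^n}{n!}=\frac{1}{e^{-tx}+e^{-ty}-t(e^x-1)(e^y-1)-1}.$$
   Context: $\mathcal{A}_{m,n}$ is the real hyperplane arrangement, in the space $\mathbb{R}^{m+n}$ with coordinates $x_1,\dots,x_m,y_1,\dots,y_n$, consisting of the $mn$ hyperplanes $x_i=y_j$ for $1\le i\le m$, $1\le j\le n$. A face of $\mathcal{A}_{m,n}$ is a nonempty set of points obtained by prescribing, for each pair $(i,j)$, exactly one of $x_i<y_j$, $x_i=y_j$, $x_i>y_j$. Its dimension is the dimension of its affine span in $\mathbb{R}^{m+n}$. If $m=0$ or $n=0$ the arrangement is empty, and its only face is the whole space, of dimension $m+n$ (in particular $f_{0,0,0}=1$). *)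

theory Defs
  imports
    "HOL-Analysis.Analysis"
    "HOL-Analysis.Finite_Function_Topology"
    "HOL-Computational_Algebra.Formal_Power_Series"
begin

section \<open>The arrangement\<close>

text \<open>
  The dimension of the ambient space must vary inside a formula, so the space with coordinates
  \<open>x\<^sub>1, \<dots>, x\<^sub>m, y\<^sub>1, \<dots>, y\<^sub>n\<close> is the set of finitely supported functions supported on the
  corresponding \<open>m + n\<close> indices, inside the real vector space of all finitely supported
  functions on \<open>nat + nat\<close>. The index \<open>Inl i\<close> stands for \<open>x\<^sub>i\<close> and \<open>Inr j\<close> for \<open>y\<^sub>j\<close>.
\<close>

type_synonym point = "(nat + nat) \<Rightarrow>\<^sub>0 real"

definition xcoord :: "point \<Rightarrow> nat \<Rightarrow> real" where
  "xcoord p i = Poly_Mapping.lookup p (Inl i)"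

definition ycoord :: "point \<Rightarrow> nat \<Rightarrow> real" where
  "ycoord p j = Poly_Mapping.lookup p (Inr j)"

definition ambient :: "nat \<Rightarrow> nat \<Rightarrow> point set" where
  "ambient m n = {p. Poly_Mapping.keys p \<subseteq> Inl ` {1..m} \<union> Inr ` {1..n}}"

definition faces :: "nat \<Rightarrow> nat \<Rightarrow> point set set" where
  "faces m n = {F. F \<noteq> {} \<and>
     (\<exists>R :: nat \<Rightarrow> nat \<Rightarrow> real \<Rightarrow> real \<Rightarrow> bool.
        (\<forall>i\<in>{1..m}. \<forall>j\<in>{1..n}. R i j \<in> {(<), (=), (>)}) \<and>
        F = {p \<in> ambient m n. \<forall>i\<in>{1..m}. \<forall>j\<in>{1..n}. R i j (xcoord p i) (ycoord p j)})}"

text \<open>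
  The library's \<open>aff_dim\<close> is restricted to types of class \<open>euclidean_space\<close>. Here the dimension
  of the affine span is the dimension of its direction space; this is only meant for nonempty
  sets with finite-dimensional span.
\<close>

definition affine_span_dim :: "'a::real_vector set \<Rightarrow> nat" where
  "affine_span_dim F = dim {u - v | u v. u \<in> affine hull F \<and> v \<in> affine hull F}"

definition num_faces :: "nat \<Rightarrow> nat \<Rightarrow> nat \<Rightarrow> nat" where
  "num_faces k m n = card {F \<in> faces m n. affine_span_dim F = k}"


section \<open>Formal power series in three variables\<close>

text \<open>
  Power series in \<open>t\<close> are nested innermost and those in \<open>y\<close> outermost; the exponents of
  \<open>t, x, y\<close> are passed in this order. At the nested type, \<open>1 / d\<close> for the library's division
  of power series is the multiplicative inverse of \<open>d\<close> whenever \<open>d\<close> has nonzero constant coefficient.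
\<close>

type_synonym series3 = "real fps fps fps"

definition series3 :: "(nat \<Rightarrow> nat \<Rightarrow> nat \<Rightarrow> real) \<Rightarrow> series3" where
  "series3 a = Abs_fps (\<lambda>n. Abs_fps (\<lambda>m. Abs_fps (\<lambda>k. a k m n)))"

definition coeff3 :: "series3 \<Rightarrow> nat \<Rightarrow> nat \<Rightarrow> nat \<Rightarrow> real" where
  "coeff3 f k m n = fps_nth (fps_nth (fps_nth f n) m) k"

definition var_t :: series3 where "var_t = fps_const (fps_const fps_X)"
definition var_x :: series3 where "var_x = fps_const fps_X"
definition var_y :: series3 where "var_y = fps_X"

text \<open>
  The exponential \<open>\<Sum>j. z ^ j / j!\<close> of a series \<open>z\<close> with zero constant coefficient. Then all
  monomials of \<open>z ^ j\<close> have total degree at least \<open>j\<close>, so truncating the sum at the total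
  degree of the requested coefficient loses nothing. (The library's \<open>fps_exp\<close> needs a field as
  coefficient ring.)
\<close>

definition exp3 :: "series3 \<Rightarrow> series3" where
  "exp3 z = series3 (\<lambda>k m n. \<Sum>j\<le>k + m + n. coeff3 (z ^ j) k m n / fact j)"

end

theory Submission
  imports Defs
begin

text \<open>
  A face is a realizable sign vector \<open>(sgn (x i - y j))\<close> on \<open>I \<times> J\<close>, and its dimension is the number
  of \<open>x i\<close> equal to no \<open>y j\<close>, plus the number of \<open>y j\<close> equal to no \<open>x i\<close>, plus the number of common
  values. Look at the bottom of a face. Either some \<open>x i\<close> lie below all \<open>y j\<close>, or some \<open>y j\<close> lie below
  all \<open>x i\<close>, or the smallest value is attained exactly by a nonempty set \<open>C\<close> of \<open>x i\<close> and a nonempty set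
  \<open>D\<close> of \<open>y j\<close>. For any \<open>A \<subseteq> I\<close>, the faces with all of \<open>A\<close> below every \<open>y j\<close> correspond to the faces
  on \<open>(I - A) \<times> J\<close>, with dimension lowered by \<open>card A\<close>, so inclusion-exclusion over nonempty \<open>A\<close>
  counts the first case. This is the factor \<open>1 - exp (- t x)\<close>; the second case gives
  \<open>1 - exp (- t y)\<close>, and the third gives \<open>t (exp x - 1) (exp y - 1)\<close>. Hence the generating
  function \<open>F\<close> is \<open>1\<close> plus \<open>F\<close> times the sum of these three, which is the claim.
\<close>

unbundle no vec_syntax
unbundle fps_syntax

section \<open>Sign vectors and dimension\<close>

text \<open>Arbitrary index sets are allowed because the recurrence deletes arbitrary sets of rows
  and columns. The value 0 off the index rectangle makes each sign pattern a single
  function.\<close>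

definition sign_vector ::
  "nat set \<Rightarrow> nat set \<Rightarrow> (nat \<Rightarrow> real) \<Rightarrow> (nat \<Rightarrow> real) \<Rightarrow> nat \<Rightarrow> nat \<Rightarrow> real" where
  "sign_vector I J x y = (\<lambda>i j. if i \<in> I \<and> j \<in> J then sgn (x i - y j) else 0)"

definition sign_vectors :: "nat set \<Rightarrow> nat set \<Rightarrow> (nat \<Rightarrow> nat \<Rightarrow> real) set" where
  "sign_vectors I J = {sign_vector I J x y | x y. True}"

text \<open>
  The third summand counts the values common to the \<open>x i\<close> and the \<open>y j\<close>: rows with the same such
  value share a nonempty zero set, and different values have disjoint ones.
\<close>

definition face_dim :: "nat set \<Rightarrow> nat set \<Rightarrow> (nat \<Rightarrow> nat \<Rightarrow> real) \<Rightarrow> nat" where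
  "face_dim I J s = card {i \<in> I. \<forall>j\<in>J. s i j \<noteq> 0} + card {j \<in> J. \<forall>i\<in>I. s i j \<noteq> 0}
     + card ((\<lambda>i. {j \<in> J. s i j = 0}) ` I - {{}})"

lemma sign_vectorsI [intro]: "sign_vector I J x y \<in> sign_vectors I J"
  by (auto simp: sign_vectors_def)

lemma sign_vectorsE:
  assumes "s \<in> sign_vectors I J"
  obtains x y where "s = sign_vector I J x y"
  using assms by (auto simp: sign_vectors_def)

lemma face_dim_sign_vector:
  "face_dim I J (sign_vector I J x y) =
     card {i \<in> I. x i \<notin> y ` J} + card {j \<in> J. y j \<notin> x ` I} + card (x ` I \<inter> y ` J)"
proof -
  let ?s = "sign_vector I J x y"
  have "(\<lambda>i. {j \<in> J. ?s i j = 0}) ` I = (\<lambda>z. {j \<in> J. y j = z}) ` x ` I"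
    unfolding image_image by (intro image_cong) (auto simp: sign_vector_def sgn_zero_iff)
  also have "\<dots> - {{}} = (\<lambda>z. {j \<in> J. y j = z}) ` {z \<in> x ` I. {j \<in> J. y j = z} \<noteq> {}}"
    by blast
  also have "{z \<in> x ` I. {j \<in> J. y j = z} \<noteq> {}} = x ` I \<inter> y ` J"
    by (force simp: image_iff)
  finally have "(\<lambda>i. {j \<in> J. ?s i j = 0}) ` I - {{}} = (\<lambda>z. {j \<in> J. y j = z}) ` (x ` I \<inter> y ` J)" .
  moreover have "inj_on (\<lambda>z. {j \<in> J. y j = z}) (x ` I \<inter> y ` J)"
    by (auto simp: inj_on_def)
  moreover have "{i \<in> I. \<forall>j\<in>J. ?s i j \<noteq> 0} = {i \<in> I. x i \<notin> y ` J}"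
    "{j \<in> J. \<forall>i\<in>I. ?s i j \<noteq> 0} = {j \<in> J. y j \<notin> x ` I}"
    by (auto simp: sign_vector_def sgn_zero_iff image_iff)
  ultimately show ?thesis
    by (simp add: face_dim_def card_image)
qed

section \<open>Dimension of a subspace cut out by equalities of coordinates\<close>

lemma lookup_scaleR_poly_mapping:
  "Poly_Mapping.lookup (r *\<^sub>R v) u = r *\<^sub>R Poly_Mapping.lookup v u"
  unfolding scaleR_poly_mapping_def
  by (subst lookup_Abs_poly_mapping) (auto intro: finite_subset[OF _ finite_keys[of v]] simp: in_keys_iff)

text \<open>The indicator functions of the classes of \<open>c\<close> on \<open>U\<close> form a
  basis: evaluating a combination at a point of a class reads off the coefficient of that
  class.\<close>

lemma dim_constant_on_classes:
  fixes c :: "'a \<Rightarrow> 'b"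
  assumes fin: "finite U"
  shows "dim {v :: 'a \<Rightarrow>\<^sub>0 real. Poly_Mapping.keys v \<subseteq> U \<and>
      (\<forall>u\<in>U. \<forall>u'\<in>U. c u = c u' \<longrightarrow> Poly_Mapping.lookup v u = Poly_Mapping.lookup v u')} =
    card (c ` U)" (is "dim ?V = _")
proof -
  define ind :: "'b \<Rightarrow> 'a \<Rightarrow>\<^sub>0 real" where
    "ind z = Abs_poly_mapping (\<lambda>u. if u \<in> U \<and> c u = z then 1 else 0)" for z
  have lookup_ind: "Poly_Mapping.lookup (ind z) u = (if u \<in> U \<and> c u = z then 1 else 0)" for z u
    unfolding ind_def using fin by (subst lookup_Abs_poly_mapping) (auto intro: finite_subset[OF _ fin])
  have inj: "inj_on ind (c ` U)"
  proof (rule inj_onI, clarify)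
    fix u u' assume "u \<in> U" "u' \<in> U" "ind (c u) = ind (c u')"
    then have "Poly_Mapping.lookup (ind (c u')) u = 1"
      using lookup_ind[of "c u" u] by simp
    then show "c u = c u'"
      by (auto simp: lookup_ind split: if_splits)
  qed
  have eval: "Poly_Mapping.lookup (\<Sum>z\<in>c ` U. g z *\<^sub>R ind z) u = (if u \<in> U then g (c u) else 0)" for g u
  proof -
    have "Poly_Mapping.lookup (\<Sum>z\<in>c ` U. g z *\<^sub>R ind z) u =
        (\<Sum>z\<in>c ` U. if z = c u then (if u \<in> U then g (c u) else 0) else 0)"
      by (auto simp: lookup_sum lookup_scaleR_poly_mapping lookup_ind intro!: sum.cong)
    then show ?thesis using fin by (auto simp: sum.delta)
  qed
  have "independent (ind ` c ` U)"
  proof (rule independent_if_scalars_zero)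
    fix f v assume 0: "(\<Sum>w\<in>ind ` c ` U. f w *\<^sub>R w) = 0" and "v \<in> ind ` c ` U"
    then obtain u where u: "u \<in> U" "v = ind (c u)" by auto
    have "(\<Sum>z\<in>c ` U. f (ind z) *\<^sub>R ind z) = 0"
      using 0 by (simp add: sum.reindex[OF inj])
    then show "f v = 0"
      using eval[of "\<lambda>z. f (ind z)" u] u by simp
  qed (use fin in simp)
  moreover have "ind ` c ` U \<subseteq> ?V"
    by (auto simp: lookup_ind in_keys_iff split: if_splits)
  moreover have "?V \<subseteq> span (ind ` c ` U)"
  proof
    fix v assume v: "v \<in> ?V"
    \<comment> \<open>The choice of representative is immaterial, since \<open>v\<close> is constant
      on each class.\<close>
    define g where "g z = Poly_Mapping.lookup v (SOME u. u \<in> U \<and> c u = z)" for z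
    have g: "g (c u) = Poly_Mapping.lookup v u" if "u \<in> U" for u
    proof -
      have "(SOME u'. u' \<in> U \<and> c u' = c u) \<in> U \<and> c (SOME u'. u' \<in> U \<and> c u' = c u) = c u"
        by (rule someI[of _ u]) (use that in simp)
      then show ?thesis using v that unfolding g_def by blast
    qed
    have "Poly_Mapping.lookup v u = 0" if "u \<notin> U" for u
      using v that by (simp add: subset_iff in_keys_iff) metis
    then have "v = (\<Sum>z\<in>c ` U. g z *\<^sub>R ind z)"
      by (intro poly_mapping_eqI) (simp add: eval g)
    moreover have "(\<Sum>z\<in>c ` U. g z *\<^sub>R ind z) \<in> span (ind ` c ` U)"
      by (intro span_sum span_scale span_base imageI)
    ultimately show "v \<in> span (ind ` c ` U)" by simp
  qed
  ultimately have "dim ?V = card (ind ` c ` U)"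
    by (intro dim_unique) auto
  then show ?thesis by (simp add: card_image[OF inj])
qed

text \<open>This will be the direction space of the face through the point with coordinates
  \<open>x\<close>, \<open>y\<close>. The forced equalities split the coordinates into classes, and
  the dimension is the number of classes.\<close>

lemma dim_equal_coordinates:
  assumes fin: "finite I" "finite J"
  shows "dim {v :: point. Poly_Mapping.keys v \<subseteq> Inl ` I \<union> Inr ` J \<and>
      (\<forall>i\<in>I. \<forall>j\<in>J. x i = y j \<longrightarrow> xcoord v i = ycoord v j)} =
    face_dim I J (sign_vector I J x y)" (is "dim ?V = _")
proof -
  let ?U = "Inl ` I \<union> Inr ` J :: (nat + nat) set"
  let ?Z = "x ` I \<inter> y ` J"
  define val where "val = case_sum x y"
  \<comment> \<open>A value common to both sides labels one merged class; every other coordinate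
    keeps its own label. Equal \<open>x i\<close> that meet no \<open>y j\<close> thus stay
    separate, because no hyperplane compares them.\<close>
  define c where "c u = (if val u \<in> ?Z then Inr (val u) else Inl u)" for u
  have [simp]: "val (Inl i) = x i" "val (Inr j) = y j" for i j
    by (simp_all add: val_def)
  have "?V = {v. Poly_Mapping.keys v \<subseteq> ?U \<and>
      (\<forall>u\<in>?U. \<forall>u'\<in>?U. c u = c u' \<longrightarrow> Poly_Mapping.lookup v u = Poly_Mapping.lookup v u')}"
    (is "_ = ?W")
  proof (intro equalityI subsetI)
    fix v assume v: "v \<in> ?V"
    \<comment> \<open>Coordinates on the same side are compared through one on the other side, so
      all coordinates with a common value are forced to agree.\<close>
    have common: "\<exists>a. \<forall>u\<in>?U. val u = z \<longrightarrow> Poly_Mapping.lookup v u = a" if "z \<in> ?Z" for z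
    proof -
      obtain i j where "i \<in> I" "j \<in> J" "x i = z" "y j = z" using \<open>z \<in> ?Z\<close> by auto
      with v have "\<forall>u\<in>?U. val u = z \<longrightarrow> Poly_Mapping.lookup v u = xcoord v i"
        by (auto simp: xcoord_def ycoord_def) metis
      then show ?thesis by blast
    qed
    have "Poly_Mapping.lookup v u = Poly_Mapping.lookup v u'"
      if "u \<in> ?U" "u' \<in> ?U" "c u = c u'" for u u'
    proof (cases "val u \<in> ?Z")
      case True
      then have "val u' = val u" using that(3) by (auto simp: c_def split: if_splits)
      with common[OF True] that show ?thesis by metis
    next
      case False
      then show ?thesis using that(3) by (auto simp: c_def split: if_splits)
    qed
    moreover have "Poly_Mapping.keys v \<subseteq> ?U" using v by simp
    ultimately show "v \<in> ?W" by blast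
  next
    fix v assume v: "v \<in> ?W"
    have "xcoord v i = ycoord v j" if "i \<in> I" "j \<in> J" "x i = y j" for i j
    proof -
      have "c (Inl i) = c (Inr j)" using that by (auto simp: c_def image_iff intro: bexI[of _ i])
      with v that show ?thesis unfolding xcoord_def ycoord_def by blast
    qed
    moreover have "Poly_Mapping.keys v \<subseteq> ?U" using v by simp
    ultimately show "v \<in> ?V" by blast
  qed
  then have "dim ?V = card (c ` ?U)"
    using dim_constant_on_classes[of ?U c] fin by simp
  also have "c ` ?U = (Inl \<circ> Inl) ` {i \<in> I. x i \<notin> y ` J} \<union> (Inl \<circ> Inr) ` {j \<in> J. y j \<notin> x ` I} \<union> Inr ` ?Z"
  proof (intro equalityI subsetI)
    fix w assume "w \<in> c ` ?U"
    then consider i where "i \<in> I" "w = c (Inl i)" | j where "j \<in> J" "w = c (Inr j)"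
      by blast
    then show "w \<in> (Inl \<circ> Inl) ` {i \<in> I. x i \<notin> y ` J} \<union> (Inl \<circ> Inr) ` {j \<in> J. y j \<notin> x ` I} \<union> Inr ` ?Z"
    proof cases
      case (1 i) then show ?thesis by (cases "x i \<in> y ` J") (simp_all add: c_def)
    next
      case (2 j) then show ?thesis by (cases "y j \<in> x ` I") (simp_all add: c_def)
    qed
  next
    fix w assume w: "w \<in> (Inl \<circ> Inl) ` {i \<in> I. x i \<notin> y ` J} \<union> (Inl \<circ> Inr) ` {j \<in> J. y j \<notin> x ` I} \<union> Inr ` ?Z"
    then consider i where "i \<in> I" "x i \<notin> y ` J" "w = Inl (Inl i)"
      | j where "j \<in> J" "y j \<notin> x ` I" "w = Inl (Inr j)"
      | i where "i \<in> I" "x i \<in> ?Z" "w = Inr (x i)" by auto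
    then show "w \<in> c ` ?U"
    proof cases
      case (1 i) then show ?thesis by (intro image_eqI[of _ _ "Inl i"]) (auto simp: c_def)
    next
      case (2 j) then show ?thesis by (intro image_eqI[of _ _ "Inr j"]) (auto simp: c_def)
    next
      case (3 i) then show ?thesis by (intro image_eqI[of _ _ "Inl i"]) (auto simp: c_def)
    qed
  qed
  also have "card \<dots> = card {i \<in> I. x i \<notin> y ` J} + card {j \<in> J. y j \<notin> x ` I} + card ?Z"
  proof -
    define P Q R :: "((nat + nat) + real) set" where "P = (Inl \<circ> Inl) ` {i \<in> I. x i \<notin> y ` J}"
      and "Q = (Inl \<circ> Inr) ` {j \<in> J. y j \<notin> x ` I}" and "R = Inr ` ?Z"
    have "finite P" "finite Q" "finite R" "P \<inter> Q = {}" "(P \<union> Q) \<inter> R = {}"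
      using fin by (auto simp: P_def Q_def R_def)
    then have "card (P \<union> Q \<union> R) = card P + card Q + card R"
      by (simp add: card_Un_disjoint)
    then show ?thesis by (simp add: P_def Q_def R_def card_image inj_on_def)
  qed
  finally show ?thesis by (simp add: face_dim_sign_vector)
qed

section \<open>Faces as sign vectors\<close>

definition sign_face :: "nat \<Rightarrow> nat \<Rightarrow> (nat \<Rightarrow> nat \<Rightarrow> real) \<Rightarrow> point set" where
  "sign_face m n s =
     {p \<in> ambient m n. \<forall>i\<in>{1..m}. \<forall>j\<in>{1..n}. sgn (xcoord p i - ycoord p j) = s i j}"

lemma exists_point:
  "\<exists>p\<in>ambient m n. (\<forall>i\<in>{1..m}. xcoord p i = x i) \<and> (\<forall>j\<in>{1..n}. ycoord p j = y j)"
proof -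
  let ?U = "Inl ` {1..m} \<union> Inr ` {1..n} :: (nat + nat) set"
  define p :: point where "p = Abs_poly_mapping (\<lambda>u. if u \<in> ?U then case_sum x y u else 0)"
  have "Poly_Mapping.lookup p u = (if u \<in> ?U then case_sum x y u else 0)" for u
    unfolding p_def
    by (subst lookup_Abs_poly_mapping) (auto intro: finite_subset[of _ ?U])
  then show ?thesis
    by (intro bexI[of _ p]) (auto simp: xcoord_def ycoord_def ambient_def in_keys_iff split: if_splits)
qed

lemma sign_face_nonempty:
  assumes "s \<in> sign_vectors {1..m} {1..n}"
  shows "sign_face m n s \<noteq> {}"
proof -
  obtain x y where s: "s = sign_vector {1..m} {1..n} x y"
    using assms by (rule sign_vectorsE)
  obtain p where "p \<in> ambient m n" "\<forall>i\<in>{1..m}. xcoord p i = x i" "\<forall>j\<in>{1..n}. ycoord p j = y j"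
    using exists_point by blast
  then have "p \<in> sign_face m n s" by (simp add: sign_face_def s sign_vector_def)
  then show ?thesis by blast
qed

lemma sign_vector_point:
  assumes "p \<in> sign_face m n s" "s \<in> sign_vectors {1..m} {1..n}"
  shows "s = sign_vector {1..m} {1..n} (xcoord p) (ycoord p)"
  using assms by (intro ext) (auto simp: sign_face_def sign_vector_def elim!: sign_vectorsE)

text \<open>The set is nonempty, and any of its points recovers the sign vector, including the zeros
  off the index rectangle.\<close>

lemma inj_on_sign_face: "inj_on (sign_face m n) (sign_vectors {1..m} {1..n})"
proof (rule inj_onI)
  fix s s' assume *: "s \<in> sign_vectors {1..m} {1..n}" "s' \<in> sign_vectors {1..m} {1..n}"
    "sign_face m n s = sign_face m n s'"
  obtain p where "p \<in> sign_face m n s" using sign_face_nonempty[OF *(1)] by blast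
  then show "s = s'" using * sign_vector_point by metis
qed

text \<open>The three relations correspond to the signs -1, 0, 1 of a difference of coordinates.
  Nonemptiness of a face supplies a point realizing its signs; conversely, realizability makes the
  set nonempty.\<close>

lemma faces_eq_sign_faces: "faces m n = sign_face m n ` sign_vectors {1..m} {1..n}"
proof (intro equalityI subsetI)
  fix F assume "F \<in> faces m n"
  then obtain R p where R: "\<forall>i\<in>{1..m}. \<forall>j\<in>{1..n}. R i j \<in> {(<), (=), (>)}"
    and F: "F = {p \<in> ambient m n. \<forall>i\<in>{1..m}. \<forall>j\<in>{1..n}. R i j (xcoord p i) (ycoord p j)}"
    and p: "p \<in> F"
    unfolding faces_def by blast
  let ?s = "sign_vector {1..m} {1..n} (xcoord p) (ycoord p)"
  have "R i j (xcoord q i) (ycoord q j) \<longleftrightarrow> sgn (xcoord q i - ycoord q j) = ?s i j"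
    if "i \<in> {1..m}" "j \<in> {1..n}" for i j q
  proof -
    have "R i j \<in> {(<), (=), (>)}" "R i j (xcoord p i) (ycoord p j)"
      using R F p that by blast+
    then show ?thesis
      using that by (auto simp: sign_vector_def sgn_if)
  qed
  then have "F = sign_face m n ?s"
    unfolding F sign_face_def by blast
  then show "F \<in> sign_face m n ` sign_vectors {1..m} {1..n}"
    by blast
next
  fix F assume "F \<in> sign_face m n ` sign_vectors {1..m} {1..n}"
  then obtain s where s: "s \<in> sign_vectors {1..m} {1..n}" and F: "F = sign_face m n s" by blast
  define R :: "nat \<Rightarrow> nat \<Rightarrow> real \<Rightarrow> real \<Rightarrow> bool" where
    "R i j = (if s i j = 0 then (=) else if s i j = 1 then (>) else (<))" for i j
  have "sgn (xcoord q i - ycoord q j) = s i j \<longleftrightarrow> R i j (xcoord q i) (ycoord q j)"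
    if "i \<in> {1..m}" "j \<in> {1..n}" for i j q
  proof -
    \<comment> \<open>Realizability excludes other real entries, so the last branch of
      \<open>R\<close> stands for the sign -1.\<close>
    have "s i j \<in> {-1, 0, 1}" using s by (auto simp: sign_vector_def sgn_if elim!: sign_vectorsE)
    then show ?thesis by (auto simp: R_def sgn_if)
  qed
  then have "F = {p \<in> ambient m n. \<forall>i\<in>{1..m}. \<forall>j\<in>{1..n}. R i j (xcoord p i) (ycoord p j)}"
    unfolding F sign_face_def by blast
  moreover have "\<forall>i\<in>{1..m}. \<forall>j\<in>{1..n}. R i j \<in> {(<), (=), (>)}"
    by (simp add: R_def)
  moreover have "F \<noteq> {}" using sign_face_nonempty[OF s] F by simp
  ultimately show "F \<in> faces m n" unfolding faces_def by blast
qed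

text \<open>Containment in the translate of \<open>L\<close> by \<open>p\<close> bounds the span
  from above. Conversely, a positive step along each direction of \<open>L\<close> stays in
  \<open>F\<close>, so the affine hull contains \<open>p + v\<close> for every \<open>v\<close> in
  \<open>L\<close>.\<close>

lemma affine_span_dim_relatively_open:
  assumes L: "subspace L" and p: "p \<in> F" and sub: "F \<subseteq> (+) p ` L"
    and opn: "\<And>v. v \<in> L \<Longrightarrow> \<exists>e>0. p + e *\<^sub>R v \<in> F"
  shows "affine_span_dim F = dim L"
proof -
  have hull: "affine hull F \<subseteq> (+) p ` L"
    using sub L by (intro hull_minimal) (auto simp: affine_translation[symmetric] intro: subspace_imp_affine)
  have "{u - v | u v. u \<in> affine hull F \<and> v \<in> affine hull F} = L"
  proof (intro equalityI subsetI)
    fix w assume "w \<in> {u - v | u v. u \<in> affine hull F \<and> v \<in> affine hull F}"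
    then obtain a b where "w = (p + a) - (p + b)" "a \<in> L" "b \<in> L" using hull by blast
    then show "w \<in> L" using subspace_diff[OF L] by simp
  next
    fix v assume "v \<in> L"
    then obtain e where e: "e > 0" "p + e *\<^sub>R v \<in> F" using opn by blast
    \<comment> \<open>This affine combination stretches the step \<open>e *\<^sub>R v\<close> to
      \<open>v\<close>; the weight \<open>1 - 1 / e\<close> may be negative.\<close>
    have "(1 - 1 / e) *\<^sub>R p + (1 / e) *\<^sub>R (p + e *\<^sub>R v) \<in> affine hull F"
      using p e by (intro mem_affine affine_affine_hull hull_inc) auto
    also have "(1 - 1 / e) *\<^sub>R p + (1 / e) *\<^sub>R (p + e *\<^sub>R v) = p + v"
      using e by (simp add: algebra_simps)
    finally have "p + v \<in> affine hull F" .
    moreover have "p \<in> affine hull F" using p by (rule hull_inc)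
    moreover have "v = (p + v) - p" by simp
    ultimately show "v \<in> {u - v | u v. u \<in> affine hull F \<and> v \<in> affine hull F}" by blast
  qed
  then show ?thesis by (simp add: affine_span_dim_def)
qed

text \<open>A nonzero sign survives a small change by continuity; the hypothesis keeps a zero equal
  to zero along the whole line.\<close>

lemma eventually_sgn_perturb:
  fixes a b :: real
  assumes "a = 0 \<Longrightarrow> b = 0"
  shows "eventually (\<lambda>e. sgn (a + e * b) = sgn a) (at_right 0)"
proof -
  have lim: "((\<lambda>e. a + e * b) \<longlongrightarrow> a) (at_right 0)"
    by (auto intro!: tendsto_eq_intros)
  consider "a = 0" | "a > 0" | "a < 0" by linarith
  then show ?thesis
  proof cases
    case 1 then show ?thesis using assms by simp
  next
    case 2 then show ?thesis using order_tendstoD(1)[OF lim, of 0] by (auto elim: eventually_mono)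
  next
    case 3 then show ?thesis using order_tendstoD(2)[OF lim, of 0] by (auto elim: eventually_mono)
  qed
qed

lemma coord_simps [simp]:
  "xcoord (p + q) i = xcoord p i + xcoord q i" "xcoord (r *\<^sub>R p) i = r * xcoord p i"
  "ycoord (p + q) i = ycoord p i + ycoord q i" "ycoord (r *\<^sub>R p) i = r * ycoord p i"
  "xcoord (p - q) i = xcoord p i - xcoord q i" "ycoord (p - q) i = ycoord p i - ycoord q i"
  "xcoord 0 i = 0" "ycoord 0 i = 0"
  by (simp_all add: xcoord_def ycoord_def lookup_add lookup_minus lookup_scaleR_poly_mapping)

lemma subspace_ambient: "subspace (ambient m n)"
proof -
  have "p \<in> ambient m n \<longleftrightarrow> (\<forall>u. u \<notin> Inl ` {1..m} \<union> Inr ` {1..n} \<longrightarrow> Poly_Mapping.lookup p u = 0)" for p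
    unfolding ambient_def by (auto simp only: mem_Collect_eq subset_iff in_keys_iff)
  then show ?thesis
    by (simp add: subspace_def lookup_add lookup_scaleR_poly_mapping)
qed

text \<open>The directions at a point \<open>p\<close> of the face are those preserving the
  equalities that hold at \<open>p\<close>; the finitely many strict inequalities survive a small
  enough step.\<close>

lemma affine_span_dim_sign_face:
  assumes s: "s \<in> sign_vectors {1..m} {1..n}"
  shows "affine_span_dim (sign_face m n s) = face_dim {1..m} {1..n} s"
proof -
  obtain p where p: "p \<in> sign_face m n s" using sign_face_nonempty[OF s] by blast
  let ?L = "{v \<in> ambient m n. \<forall>i\<in>{1..m}. \<forall>j\<in>{1..n}.
    xcoord p i = ycoord p j \<longrightarrow> xcoord v i = ycoord v j}"
  have "affine_span_dim (sign_face m n s) = dim ?L"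
  proof (rule affine_span_dim_relatively_open[OF _ p])
    show "subspace ?L"
      using subspace_ambient[of m n] by (simp add: subspace_def)
    show "sign_face m n s \<subseteq> (+) p ` ?L"
    proof
      fix q assume q: "q \<in> sign_face m n s"
      have "q - p \<in> ambient m n"
        using p q subspace_diff[OF subspace_ambient] by (simp add: sign_face_def)
      moreover have "xcoord q i = ycoord q j"
        if "i \<in> {1..m}" "j \<in> {1..n}" "xcoord p i = ycoord p j" for i j
      proof -
        have "sgn (xcoord q i - ycoord q j) = sgn (xcoord p i - ycoord p j)"
          using p q that(1,2) by (simp add: sign_face_def)
        then show ?thesis using that(3) by (simp add: sgn_zero_iff)
      qed
      ultimately have "q - p \<in> ?L" by auto
      then show "q \<in> (+) p ` ?L" by (intro image_eqI[of _ _ "q - p"]) simp_all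
    qed
    fix v assume v: "v \<in> ?L"
    have "eventually (\<lambda>e. \<forall>i\<in>{1..m}. \<forall>j\<in>{1..n}.
        sgn ((xcoord p i - ycoord p j) + e * (xcoord v i - ycoord v j)) =
        sgn (xcoord p i - ycoord p j)) (at_right 0)"
      using v by (intro eventually_ball_finite ballI eventually_sgn_perturb) auto
    then have "eventually (\<lambda>e. e > 0 \<and> (\<forall>i\<in>{1..m}. \<forall>j\<in>{1..n}.
        sgn ((xcoord p i - ycoord p j) + e * (xcoord v i - ycoord v j)) =
        sgn (xcoord p i - ycoord p j))) (at_right 0)"
      by (intro eventually_conj eventually_at_right_less)
    then obtain e :: real where e: "e > 0" "\<forall>i\<in>{1..m}. \<forall>j\<in>{1..n}.
        sgn ((xcoord p i - ycoord p j) + e * (xcoord v i - ycoord v j)) = sgn (xcoord p i - ycoord p j)"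
      by (rule eventually_happens'[OF trivial_limit_at_right_real, THEN exE]) blast
    have "p + e *\<^sub>R v \<in> ambient m n"
      using p v subspace_ambient[of m n] by (simp add: sign_face_def subspace_def)
    moreover have "sgn (xcoord (p + e *\<^sub>R v) i - ycoord (p + e *\<^sub>R v) j) = s i j"
      if "i \<in> {1..m}" "j \<in> {1..n}" for i j
      using e(2) p that by (simp add: sign_face_def algebra_simps)
    ultimately have "p + e *\<^sub>R v \<in> sign_face m n s" by (simp add: sign_face_def)
    with e(1) show "\<exists>e>0. p + e *\<^sub>R v \<in> sign_face m n s" by blast
  qed
  also have "dim ?L = face_dim {1..m} {1..n} (sign_vector {1..m} {1..n} (xcoord p) (ycoord p))"
    using dim_equal_coordinates[of "{1..m}" "{1..n}" "xcoord p" "ycoord p"] by (simp add: ambient_def)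
  finally show ?thesis using sign_vector_point[OF p s] by simp
qed

lemma num_faces_eq:
  "num_faces k m n = card {s \<in> sign_vectors {1..m} {1..n}. face_dim {1..m} {1..n} s = k}"
proof -
  have "{F \<in> faces m n. affine_span_dim F = k} =
      sign_face m n ` {s \<in> sign_vectors {1..m} {1..n}. face_dim {1..m} {1..n} s = k}"
    by (auto simp: faces_eq_sign_faces affine_span_dim_sign_face)
  moreover have "inj_on (sign_face m n) {s \<in> sign_vectors {1..m} {1..n}. face_dim {1..m} {1..n} s = k}"
    by (rule inj_on_subset[OF inj_on_sign_face]) auto
  ultimately show ?thesis by (simp add: num_faces_def card_image)
qed

section \<open>The bottom of a face\<close>

lemma finite_sign_vectors:
  assumes "finite I" "finite J"
  shows "finite (sign_vectors I J)"
proof -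
  let ?E = "\<lambda>g i j. if i \<in> I \<and> j \<in> J then g (i, j) else (0 :: real)"
  have "sign_vectors I J \<subseteq> ?E ` (I \<times> J \<rightarrow>\<^sub>E {-1, 0, 1})"
  proof
    fix s assume "s \<in> sign_vectors I J"
    then obtain x y where s: "s = sign_vector I J x y" by (rule sign_vectorsE)
    let ?g = "\<lambda>(i, j)\<in>I \<times> J. sgn (x i - y j)"
    have "?g \<in> I \<times> J \<rightarrow>\<^sub>E {-1, 0, 1}"
    proof -
      have "sgn r \<in> {-1, 0, 1}" for r :: real by (simp add: sgn_if)
      then show ?thesis by (auto simp only: restrict_PiE_iff split_def)
    qed
    moreover have "s = ?E ?g" by (intro ext) (simp add: s sign_vector_def)
    ultimately show "s \<in> ?E ` (I \<times> J \<rightarrow>\<^sub>E {-1, 0, 1})" by blast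
  qed
  then show ?thesis
    by (rule finite_subset) (use assms in \<open>auto intro!: finite_imageI finite_PiE\<close>)
qed

section \<open>Deleting rows and columns at the bottom\<close>

definition restrict_signs :: "nat set \<Rightarrow> nat set \<Rightarrow> (nat \<Rightarrow> nat \<Rightarrow> real) \<Rightarrow> nat \<Rightarrow> nat \<Rightarrow> real" where
  "restrict_signs I J s = (\<lambda>i j. if i \<in> I \<and> j \<in> J then s i j else 0)"

lemma restrict_sign_vector:
  "I' \<subseteq> I \<Longrightarrow> J' \<subseteq> J \<Longrightarrow> restrict_signs I' J' (sign_vector I J x y) = sign_vector I' J' x y"
  by (intro ext) (auto simp: restrict_signs_def sign_vector_def)

lemma sign_vectors_outside: "s \<in> sign_vectors I J \<Longrightarrow> i \<notin> I \<or> j \<notin> J \<Longrightarrow> s i j = 0"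
  by (auto simp: sign_vector_def elim!: sign_vectorsE)

lemma sgn_diff_iff:
  fixes a b :: real
  shows "sgn (a - b) = -1 \<longleftrightarrow> a < b" "sgn (a - b) = 1 \<longleftrightarrow> a > b" "sgn (a - b) = 0 \<longleftrightarrow> a = b"
  by (auto simp: sgn_if)

lemma finite_real_below:
  assumes "finite (A :: real set)"
  shows "\<exists>b. \<forall>a\<in>A. b < a"
proof (intro exI ballI)
  fix a assume "a \<in> A"
  then have "Min (insert 0 A) \<le> a" using assms by (intro Min_le) simp_all
  then show "Min (insert 0 A) - 1 < a" by simp
qed

text \<open>If \<open>J\<close> is empty, every row is vacuously low; this lets the recurrence cover
  the case without hyperplanes.\<close>

definition low_rows :: "nat set \<Rightarrow> nat set \<Rightarrow> (nat \<Rightarrow> nat \<Rightarrow> real) \<Rightarrow> nat set" where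
  "low_rows I J s = {i \<in> I. \<forall>j\<in>J. s i j = -1}"

definition low_columns :: "nat set \<Rightarrow> nat set \<Rightarrow> (nat \<Rightarrow> nat \<Rightarrow> real) \<Rightarrow> nat set" where
  "low_columns I J s = {j \<in> J. \<forall>i\<in>I. s i j = 1}"

text \<open>For a realizable \<open>s\<close> and nonempty \<open>C\<close>, \<open>D\<close> inside
  \<open>I\<close>, \<open>J\<close>, these are the rows and columns attaining the smallest
  coordinate value. Entries outside the rows \<open>C\<close> and the columns \<open>D\<close> are
  free.\<close>

definition bottom_block ::
  "nat set \<Rightarrow> nat set \<Rightarrow> nat set \<Rightarrow> nat set \<Rightarrow> (nat \<Rightarrow> nat \<Rightarrow> real) \<Rightarrow> bool" where
  "bottom_block I J C D s \<longleftrightarrow> (\<forall>i\<in>C. \<forall>j\<in>D. s i j = 0) \<and>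
     (\<forall>i\<in>C. \<forall>j\<in>J - D. s i j = -1) \<and> (\<forall>i\<in>I - C. \<forall>j\<in>D. s i j = 1)"

text \<open>The rows of \<open>A\<close> carry no information beyond the constant -1, and they can
  be put back at a value below every \<open>y j\<close>.\<close>

lemma bij_betw_remove_low_rows:
  assumes "A \<subseteq> I" "finite J"
  shows "bij_betw (restrict_signs (I - A) J) {s \<in> sign_vectors I J. A \<subseteq> low_rows I J s}
           (sign_vectors (I - A) J)" (is "bij_betw ?r ?S ?T")
  unfolding bij_betw_def
proof (intro conjI inj_onI equalityI subsetI ext)
  fix s s' i j assume s: "s \<in> ?S" "s' \<in> ?S" and eq: "?r s = ?r s'"
  have "s i j = s' i j" if "i \<in> I - A" "j \<in> J"
    using fun_cong[OF fun_cong[OF eq], of i j] that by (simp add: restrict_signs_def)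
  moreover have "s i j = s' i j" if "i \<in> A" "j \<in> J"
    using s that by (auto simp: low_rows_def subset_iff)
  moreover have "s i j = s' i j" if "i \<notin> I \<or> j \<notin> J"
    using s that sign_vectors_outside[of s I J i j] sign_vectors_outside[of s' I J i j] by simp
  ultimately show "s i j = s' i j" by blast
next
  fix t assume "t \<in> ?r ` ?S"
  then show "t \<in> ?T" by (auto simp: restrict_sign_vector elim!: sign_vectorsE)
next
  fix t assume "t \<in> ?T"
  then obtain x y where t: "t = sign_vector (I - A) J x y" by (rule sign_vectorsE)
  obtain b where b: "\<forall>j\<in>J. b < y j"
    using finite_real_below[of "y ` J"] assms(2) by auto
  let ?x = "\<lambda>i. if i \<in> A then b else x i"
  let ?s = "sign_vector I J ?x y"
  have "A \<subseteq> low_rows I J ?s"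
    using assms(1) b by (auto simp: low_rows_def sign_vector_def sgn_diff_iff)
  moreover have "t = ?r ?s"
    by (intro ext) (auto simp: t restrict_signs_def sign_vector_def)
  ultimately show "t \<in> ?r ` ?S" by blast
qed

text \<open>Each row of \<open>A\<close> meets no column, so it contributes its own free coordinate
  even when several such rows coincide. Its deletion changes no coincidence between a row and a
  column.\<close>

lemma face_dim_remove_low_rows:
  assumes s: "s \<in> sign_vectors I J" and A: "A \<subseteq> low_rows I J s" and fin: "finite I"
  shows "face_dim I J s = card A + face_dim (I - A) J (restrict_signs (I - A) J s)"
proof -
  obtain x y where s: "s = sign_vector I J x y" using s by (rule sign_vectorsE)
  have low: "x i \<noteq> y j" if "i \<in> A" "j \<in> J" for i j
    using A that by (fastforce simp: low_rows_def s sign_vector_def sgn_diff_iff)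
  have AI: "A \<subseteq> I" using A by (auto simp: low_rows_def)
  have "{i \<in> I. x i \<notin> y ` J} = A \<union> {i \<in> I - A. x i \<notin> y ` J}"
    using AI low by blast
  moreover have "card (A \<union> {i \<in> I - A. x i \<notin> y ` J}) = card A + card {i \<in> I - A. x i \<notin> y ` J}"
    using AI fin by (intro card_Un_disjoint) (auto intro: finite_subset)
  moreover have "{j \<in> J. y j \<notin> x ` I} = {j \<in> J. y j \<notin> x ` (I - A)}"
    "x ` I \<inter> y ` J = x ` (I - A) \<inter> y ` J"
    using low by (force simp: image_iff)+
  ultimately show ?thesis
    by (simp add: s restrict_sign_vector face_dim_sign_vector)
qed

text \<open>The block fixes all entries in its rows and columns, which gives injectivity. For
  surjectivity, all its coordinates are given one value below the remaining ones.\<close>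

lemma bij_betw_remove_bottom_block:
  assumes CD: "C \<subseteq> I" "D \<subseteq> J" and fin: "finite I" "finite J"
  shows "bij_betw (restrict_signs (I - C) (J - D)) {s \<in> sign_vectors I J. bottom_block I J C D s}
           (sign_vectors (I - C) (J - D))" (is "bij_betw ?r ?S ?T")
  unfolding bij_betw_def
proof (intro conjI inj_onI equalityI subsetI ext)
  fix s s' i j assume s: "s \<in> ?S" "s' \<in> ?S" and eq: "?r s = ?r s'"
  have "s i j = s' i j" if "i \<in> I - C" "j \<in> J - D"
    using fun_cong[OF fun_cong[OF eq], of i j] that by (simp add: restrict_signs_def)
  moreover have "s i j = s' i j" if "i \<in> I" "j \<in> J" "i \<in> C \<or> j \<in> D"
    using s that by (cases "i \<in> C"; cases "j \<in> D") (auto simp: bottom_block_def)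
  moreover have "s i j = s' i j" if "i \<notin> I \<or> j \<notin> J"
    using s that sign_vectors_outside[of s I J i j] sign_vectors_outside[of s' I J i j] by simp
  ultimately show "s i j = s' i j" by blast
next
  fix t assume "t \<in> ?r ` ?S"
  then show "t \<in> ?T" by (auto simp: restrict_sign_vector elim!: sign_vectorsE)
next
  fix t assume "t \<in> ?T"
  then obtain x y where t: "t = sign_vector (I - C) (J - D) x y" by (rule sign_vectorsE)
  obtain b where b: "\<forall>a\<in>x ` I \<union> y ` J. b < a"
    using finite_real_below[of "x ` I \<union> y ` J"] fin by auto
  let ?x = "\<lambda>i. if i \<in> C then b else x i" and ?y = "\<lambda>j. if j \<in> D then b else y j"
  let ?s = "sign_vector I J ?x ?y"
  have "bottom_block I J C D ?s"
    using CD b by (auto simp: bottom_block_def sign_vector_def sgn_diff_iff)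
  moreover have "t = ?r ?s"
    by (intro ext) (auto simp: t restrict_signs_def sign_vector_def)
  ultimately show "t \<in> ?r ` ?S" by blast
qed

text \<open>All coordinates of the block equal one value \<open>z\<close>, and no remaining
  coordinate does. Deletion loses exactly this common value and affects neither count of unmatched
  coordinates.\<close>

lemma face_dim_remove_bottom_block:
  assumes s: "s \<in> sign_vectors I J" and bot: "bottom_block I J C D s"
    and CD: "C \<subseteq> I" "D \<subseteq> J" "C \<noteq> {}" "D \<noteq> {}" and fin: "finite I"
  shows "face_dim I J s = Suc (face_dim (I - C) (J - D) (restrict_signs (I - C) (J - D) s))"
proof -
  obtain x y where s: "s = sign_vector I J x y" using s by (rule sign_vectorsE)
  obtain i0 j0 where ij: "i0 \<in> C" "j0 \<in> D" using CD by blast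
  define z where "z = x i0"
  have eq: "x i = y j" if "i \<in> C" "j \<in> D" for i j
    using bot that CD by (auto simp: bottom_block_def s sign_vector_def sgn_diff_iff subset_iff)
  have lt: "x i < y j" if "i \<in> C" "j \<in> J - D" for i j
    using bot that CD by (auto simp: bottom_block_def s sign_vector_def sgn_diff_iff subset_iff)
  have gt: "x i > y j" if "i \<in> I - C" "j \<in> D" for i j
    using bot that CD by (auto simp: bottom_block_def s sign_vector_def sgn_diff_iff subset_iff)
  have yD: "y j = z" if "j \<in> D" for j using eq[OF ij(1) that] by (simp add: z_def)
  have xC: "x i = z" if "i \<in> C" for i using eq[OF that ij(2)] yD[OF ij(2)] by simp
  have x: "z < x i" if "i \<in> I - C" for i using gt[OF that ij(2)] yD[OF ij(2)] by simp
  have y: "z < y j" if "j \<in> J - D" for j using lt[OF ij(1) that] by (simp add: z_def)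
  have "x ` C = {z}" "y ` D = {z}"
    using xC yD ij by (auto intro!: image_eqI)
  moreover have "x ` I = x ` C \<union> x ` (I - C)" "y ` J = y ` D \<union> y ` (J - D)"
    using CD(1,2) by blast+
  ultimately have xI: "x ` I = insert z (x ` (I - C))" and yJ: "y ` J = insert z (y ` (J - D))"
    by simp_all
  have zn: "z \<notin> x ` (I - C)" "z \<notin> y ` (J - D)" using x y by blast+
  have "i \<in> I \<and> x i \<notin> y ` J \<longleftrightarrow> i \<in> I - C \<and> x i \<notin> y ` (J - D)" for i
    using xC[of i] x[of i] unfolding yJ by (cases "i \<in> C") auto
  then have "{i \<in> I. x i \<notin> y ` J} = {i \<in> I - C. x i \<notin> y ` (J - D)}" by blast
  moreover have "j \<in> J \<and> y j \<notin> x ` I \<longleftrightarrow> j \<in> J - D \<and> y j \<notin> x ` (I - C)" for j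
    using yD[of j] y[of j] unfolding xI by (cases "j \<in> D") auto
  then have "{j \<in> J. y j \<notin> x ` I} = {j \<in> J - D. y j \<notin> x ` (I - C)}" by blast
  moreover have "x ` I \<inter> y ` J = insert z (x ` (I - C) \<inter> y ` (J - D))"
    using zn unfolding xI yJ by blast
  moreover have "card (insert z (x ` (I - C) \<inter> y ` (J - D))) = Suc (card (x ` (I - C) \<inter> y ` (J - D)))"
    using zn fin by simp
  ultimately show ?thesis
    by (simp add: s restrict_sign_vector face_dim_sign_vector)
qed

text \<open>The right-hand sides depend only on \<open>s\<close>, so different pairs cannot be
  blocks of the same sign vector. Nonemptiness supplies an entry 1 in each row outside
  \<open>C\<close> and an entry -1 in each column outside \<open>D\<close>.\<close>

lemma bottom_block_unique:
  assumes "bottom_block I J C D s" "C \<subseteq> I" "D \<subseteq> J" "C \<noteq> {}" "D \<noteq> {}"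
  shows "C = {i \<in> I. \<forall>j\<in>J. s i j \<le> 0}" "D = {j \<in> J. \<forall>i\<in>I. s i j \<ge> 0}"
proof -
  have "s i j \<le> 0" if "i \<in> C" "j \<in> J" for i j
    using assms that by (cases "j \<in> D") (auto simp: bottom_block_def)
  moreover have "s i j \<ge> 0" if "i \<in> I" "j \<in> D" for i j
    using assms that by (cases "i \<in> C") (auto simp: bottom_block_def)
  moreover have "\<exists>j\<in>J. s i j = 1" if "i \<in> I - C" for i
    using assms that unfolding bottom_block_def by blast
  moreover have "\<exists>i\<in>I. s i j = -1" if "j \<in> J - D" for j
    using assms that unfolding bottom_block_def by blast
  ultimately show "C = {i \<in> I. \<forall>j\<in>J. s i j \<le> 0}" "D = {j \<in> J. \<forall>i\<in>I. s i j \<ge> 0}"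
    using assms(2,3) by fastforce+
qed

lemma low_rows_low_columns_disjoint:
  assumes "low_rows I J s \<noteq> {}"
  shows "low_columns I J s = {}"
proof -
  obtain i where "i \<in> I" "\<forall>j\<in>J. s i j = -1" using assms by (auto simp: low_rows_def)
  then show ?thesis by (auto simp: low_columns_def intro!: bexI[of _ i])
qed

text \<open>Without low rows, the smallest \<open>x i\<close> is at least some \<open>y j\<close>;
  without low columns the reverse holds. So the two minima coincide, and the indices attaining them
  form the block.\<close>

lemma bottom_block_iff_no_low:
  assumes s: "s \<in> sign_vectors I J" and fin: "finite I" "finite J" and ne: "I \<noteq> {} \<or> J \<noteq> {}"
  shows "low_rows I J s = {} \<and> low_columns I J s = {} \<longleftrightarrow>
    (\<exists>C\<in>Pow I - {{}}. \<exists>D\<in>Pow J - {{}}. bottom_block I J C D s)" (is "?L \<longleftrightarrow> ?R")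
proof
  assume ?R
  then obtain C D where CD: "C \<subseteq> I" "D \<subseteq> J" "C \<noteq> {}" "D \<noteq> {}" and bot: "bottom_block I J C D s"
    by blast
  obtain i0 j0 where ij: "i0 \<in> C" "j0 \<in> D" using CD by blast
  have "s i j0 \<ge> 0" if "i \<in> I" for i
    using bot ij that by (cases "i \<in> C") (auto simp: bottom_block_def)
  moreover have "s i0 j \<le> 0" if "j \<in> J" for j
    using bot ij that by (cases "j \<in> D") (auto simp: bottom_block_def)
  ultimately show ?L
    using ij CD unfolding low_rows_def low_columns_def by force
next
  assume L: ?L
  obtain x y where s: "s = sign_vector I J x y" using s by (rule sign_vectorsE)
  \<comment> \<open>With one index set empty, all indices of the other would be vacuously
    low.\<close>
  have "I \<noteq> {}" "J \<noteq> {}" using L ne by (auto simp: low_rows_def low_columns_def)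
  then have mins: "Min (x ` I) \<in> x ` I" "Min (y ` J) \<in> y ` J"
    using fin by (auto intro!: Min_in)
  then obtain i0 j0 where i0: "i0 \<in> I" "x i0 = Min (x ` I)" and j0: "j0 \<in> J" "y j0 = Min (y ` J)"
    by (metis imageE)
  have xmin: "x i0 \<le> x i" if "i \<in> I" for i using fin that i0 by simp
  have ymin: "y j0 \<le> y j" if "j \<in> J" for j using fin that j0 by simp
  have "i0 \<notin> low_rows I J s" "j0 \<notin> low_columns I J s" using L by auto
  then obtain i1 j1 where "i1 \<in> I" "x i1 \<le> y j0" "j1 \<in> J" "y j1 \<le> x i0"
    using i0 j0 by (auto simp: low_rows_def low_columns_def s sign_vector_def sgn_diff_iff not_less)
  then have eq: "x i0 = y j0" using xmin ymin by fastforce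
  let ?C = "{i \<in> I. x i = x i0}" and ?D = "{j \<in> J. y j = x i0}"
  have "bottom_block I J ?C ?D s"
    using xmin ymin eq
    by (force simp: bottom_block_def s sign_vector_def sgn_diff_iff order_less_le)
  moreover have "?C \<in> Pow I - {{}}" "?D \<in> Pow J - {{}}" using i0 j0 eq by auto
  ultimately show ?R by blast
qed

section \<open>Coefficients of the denominator\<close>

definition face_denominator :: series3 where
  "face_denominator = exp3 (- (var_t * var_x)) + exp3 (- (var_t * var_y))
         - var_t * (exp3 var_x - 1) * (exp3 var_y - 1) - 1"

text \<open>Here \<open>fps_X\<close> is the variable t, so this is the coefficient of x^i in
  exp(-tx), and likewise of y^i in exp(-ty).\<close>

definition neg_exp_coeff :: "nat \<Rightarrow> real fps" where
  "neg_exp_coeff i = fps_const ((-1) ^ i / fact i) * fps_X ^ i"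

lemma fps_nth_exp3:
  "exp3 z $ n $ m $ k = (\<Sum>j\<le>k + m + n. z ^ j $ n $ m $ k / fact j)"
  by (simp add: exp3_def series3_def coeff3_def)

lemma minus_fps_X_power: "(- fps_X) ^ j = fps_const ((-1) ^ j) * (fps_X ^ j :: real fps)"
proof -
  have "- fps_X = fps_const (-1) * (fps_X :: real fps)"
    by (simp flip: fps_const_neg)
  then show ?thesis by (simp only: power_mult_distrib fps_const_power)
qed

text \<open>Each power of \<open>- (var_t * var_x)\<close> is a single monomial, so only the summand
  \<open>j = m\<close> of the truncated exponential can contribute, and \<open>m\<close> never
  exceeds the truncation bound.\<close>

lemma exp3_tx: "exp3 (- (var_t * var_x)) $ n $ m = (if n = 0 then neg_exp_coeff m else 0)"
proof (rule fps_ext)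
  fix k
  have "- (var_t * var_x) = fps_const (fps_const (- fps_X) * fps_X)"
    by (simp add: var_t_def var_x_def fps_const_mult flip: fps_const_neg)
  then have "(- (var_t * var_x)) ^ j = fps_const (fps_const ((- fps_X) ^ j) * fps_X ^ j)" for j
    by (simp only: fps_const_power power_mult_distrib)
  then have *: "(- (var_t * var_x)) ^ j $ n $ m $ k / fact j =
      (if j = m then if n = 0 \<and> k = m then (-1) ^ m / fact m else 0 else 0)" for j
    by (simp add: fps_X_power_nth minus_fps_X_power)
  show "exp3 (- (var_t * var_x)) $ n $ m $ k = (if n = 0 then neg_exp_coeff m else 0) $ k"
    by (simp add: fps_nth_exp3 * neg_exp_coeff_def fps_X_power_nth)
qed

lemma exp3_ty: "exp3 (- (var_t * var_y)) $ n $ m = (if m = 0 then neg_exp_coeff n else 0)"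
proof (rule fps_ext)
  fix k
  have "- (var_t * var_y) = fps_const (fps_const (- fps_X)) * fps_X"
    by (simp add: var_t_def var_y_def flip: fps_const_neg)
  then have "(- (var_t * var_y)) ^ j = fps_const (fps_const ((- fps_X) ^ j)) * fps_X ^ j" for j
    by (simp only: fps_const_power power_mult_distrib)
  then have *: "(- (var_t * var_y)) ^ j $ n $ m $ k / fact j =
      (if j = n then if m = 0 \<and> k = n then (-1) ^ n / fact n else 0 else 0)" for j
    by (simp add: fps_X_power_nth minus_fps_X_power)
  show "exp3 (- (var_t * var_y)) $ n $ m $ k = (if m = 0 then neg_exp_coeff n else 0) $ k"
    by (simp add: fps_nth_exp3 * neg_exp_coeff_def fps_X_power_nth)
qed

lemma exp3_x:
  "exp3 var_x = fps_const (Abs_fps (\<lambda>m. fps_const (1 / fact m)))"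
proof (intro fps_ext)
  fix n m k
  have *: "var_x ^ j $ n $ m $ k / fact j =
      (if j = m then if n = 0 \<and> k = 0 then 1 / fact m else 0 else 0)" for j
    by (simp add: var_x_def fps_X_power_nth fps_const_power)
  show "exp3 var_x $ n $ m $ k = fps_const (Abs_fps (\<lambda>m. fps_const (1 / fact m))) $ n $ m $ k"
    by (simp add: fps_nth_exp3 *)
qed

lemma exp3_y:
  "exp3 var_y = Abs_fps (\<lambda>n. fps_const (fps_const (1 / fact n)))"
proof (intro fps_ext)
  fix n m k
  have *: "var_y ^ j $ n $ m $ k / fact j =
      (if j = n then if m = 0 \<and> k = 0 then 1 / fact n else 0 else 0)" for j
    by (simp add: var_y_def fps_X_power_nth)
  show "exp3 var_y $ n $ m $ k = Abs_fps (\<lambda>n. fps_const (fps_const (1 / fact n))) $ n $ m $ k"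
    by (simp add: fps_nth_exp3 *)
qed

text \<open>The product of the two series without constant term contributes only when both exponents
  are positive. At m = n = 0 the value is 1 + 1 - 0 - 1 = 1, which makes the denominator
  invertible.\<close>

lemma face_denominator_nth:
  "face_denominator $ n $ m =
     (if n = 0 then neg_exp_coeff m else 0) + (if m = 0 then neg_exp_coeff n else 0)
     - (if n = 0 \<or> m = 0 then 0 else fps_X * fps_const (1 / (fact m * fact n)))
     - (if n = 0 \<and> m = 0 then 1 else 0)"
proof -
  let ?a = "Abs_fps (\<lambda>m. if m = 0 then 0 else fps_const (1 / fact m)) :: real fps fps"
  let ?b = "Abs_fps (\<lambda>n. if n = 0 then 0 else fps_const (fps_const (1 / fact n))) :: series3"
  have x: "exp3 var_x - 1 = fps_const ?a"
    unfolding exp3_x by (intro fps_ext) simp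
  have y: "exp3 var_y - 1 = ?b"
    unfolding exp3_y by (intro fps_ext) simp
  have "(var_t * (exp3 var_x - 1) * (exp3 var_y - 1)) $ n $ m =
      (if n = 0 \<or> m = 0 then 0 else fps_X * fps_const (1 / (fact m * fact n)))"
    unfolding x y by (simp add: var_t_def mult.assoc fps_const_mult)
  then show ?thesis
    by (simp add: face_denominator_def exp3_tx exp3_ty)
qed

text \<open>The coefficients do not form a field, so invertibility is lifted through the nesting:
  the constant coefficient 1 makes the coefficient of y^0 invertible, and that makes the whole
  series invertible.\<close>

lemma face_denominator_mult_inverse: "face_denominator * (1 / face_denominator) = 1"
proof -
  let ?d = face_denominator
  have d00: "?d $ 0 $ 0 = 1" by (simp add: face_denominator_nth neg_exp_coeff_def)
  have "?d $ 0 * inverse (?d $ 0) = 1"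
    unfolding fps_inverse_def[of "?d $ 0"] by (rule fps_right_inverse) (simp add: d00)
  then have "?d * inverse ?d = 1"
    unfolding fps_inverse_def[of ?d] by (rule fps_right_inverse)
  moreover have "?d $ 0 \<noteq> 0" using d00 by (metis fps_zero_nth zero_neq_one)
  then have "subdegree ?d = 0" by simp
  ultimately show ?thesis by (simp add: fps_divide_unit')
qed

text \<open>Coefficients are compared in the product of the denominator and its inverse; the
  denominator's constant coefficient 1 isolates \<open>c n m\<close>. The first argument of
  \<open>c\<close> is the exponent of y.\<close>

lemma inverse_face_denominator_recurrence:
  fixes m n :: nat
  defines "c \<equiv> \<lambda>n m. (1 / face_denominator) $ n $ m"
  shows "c 0 0 = 1"
    "m + n > 0 \<Longrightarrow> c n m =
       - (\<Sum>i=1..m. neg_exp_coeff i * c n (m - i)) - (\<Sum>j=1..n. neg_exp_coeff j * c (n - j) m)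
       + fps_X * (\<Sum>i=1..m. \<Sum>j=1..n. fps_const (1 / (fact i * fact j)) * c (n - j) (m - i))"
proof -
  have "(\<Sum>j=0..n. \<Sum>i=0..m. face_denominator $ j $ i * c (n - j) (m - i)) =
      (face_denominator * (1 / face_denominator)) $ n $ m" for m n
    by (simp add: fps_mult_nth fps_sum_nth c_def)
  then have conv: "(\<Sum>j=0..n. \<Sum>i=0..m. face_denominator $ j $ i * c (n - j) (m - i)) =
      (if m + n = 0 then 1 else 0)" for m n
    by (simp add: face_denominator_mult_inverse)
  show "c 0 0 = 1"
    using conv[of 0 0] by (simp add: face_denominator_nth neg_exp_coeff_def)
  assume "m + n > 0"
  let ?e = "neg_exp_coeff"
  have e0: "?e 0 = 1" by (simp add: neg_exp_coeff_def)
  have split0: "(\<Sum>i=0..k. g i) = g 0 + (\<Sum>i=1..k. g i)" for k and g :: "nat \<Rightarrow> real fps"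
    by (simp add: sum.atLeast_Suc_atMost)
  have "(\<Sum>i=0..m. face_denominator $ 0 $ i * c n (m - i)) = c n m + (\<Sum>i=1..m. ?e i * c n (m - i))"
    unfolding split0 by (simp add: face_denominator_nth e0)
  \<comment> \<open>For positive \<open>j\<close>, the term \<open>i = 0\<close> gives the
    coefficient of exp(-ty), and positive \<open>i\<close> give the mixed product.\<close>
  moreover have "(\<Sum>i=0..m. face_denominator $ j $ i * c (n - j) (m - i)) =
      ?e j * c (n - j) m - fps_X * (\<Sum>i=1..m. fps_const (1 / (fact i * fact j)) * c (n - j) (m - i))"
    if "j \<in> {1..n}" for j
    using that unfolding split0
    by (simp add: face_denominator_nth sum_distrib_left mult.assoc sum_negf)
  ultimately have "(\<Sum>j=0..n. \<Sum>i=0..m. face_denominator $ j $ i * c (n - j) (m - i)) =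
      c n m + (\<Sum>i=1..m. ?e i * c n (m - i)) + (\<Sum>j=1..n. ?e j * c (n - j) m)
       - fps_X * (\<Sum>j=1..n. \<Sum>i=1..m. fps_const (1 / (fact i * fact j)) * c (n - j) (m - i))"
    unfolding split0[of _ n] by (simp add: sum_subtractf sum_distrib_left)
  with conv[of n m] \<open>m + n > 0\<close> show "c n m =
       - (\<Sum>i=1..m. ?e i * c n (m - i)) - (\<Sum>j=1..n. ?e j * c (n - j) m)
       + fps_X * (\<Sum>i=1..m. \<Sum>j=1..n. fps_const (1 / (fact i * fact j)) * c (n - j) (m - i))"
    by (subst sum.swap) (simp add: algebra_simps)
qed

section \<open>The recurrence for the face polynomial\<close>

lemma sum_nonempty_subsets_card:
  fixes g :: "nat \<Rightarrow> 'a :: comm_semiring_1"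
  assumes "finite S"
  shows "(\<Sum>A\<in>Pow S - {{}}. g (card A)) = (\<Sum>k=1..card S. of_nat (card S choose k) * g k)"
proof -
  have "card ` (Pow S - {{}}) \<subseteq> {1..card S}"
    using assms by (auto simp: Suc_le_eq card_gt_0_iff card_mono dest: finite_subset)
  then have "(\<Sum>A\<in>Pow S - {{}}. g (card A)) =
      (\<Sum>k=1..card S. \<Sum>A\<in>{A \<in> Pow S - {{}}. card A = k}. g (card A))"
    using assms by (intro sum.group[symmetric]) auto
  also have "\<dots> = (\<Sum>k=1..card S. of_nat (card S choose k) * g k)"
  proof (rule sum.cong)
    fix k assume "k \<in> {1..card S}"
    then have "{A \<in> Pow S - {{}}. card A = k} = {A. A \<subseteq> S \<and> card A = k}" by auto
    then show "(\<Sum>A\<in>{A \<in> Pow S - {{}}. card A = k}. g (card A)) = of_nat (card S choose k) * g k"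
      using n_subsets[OF assms, of k] by simp
  qed simp
  finally show ?thesis .
qed

text \<open>The alternating sum of binomial coefficients is 0, so leaving out the empty set gives 1.
  This is the weight used for inclusion-exclusion over low rows.\<close>

lemma sum_nonempty_subsets_alternating:
  assumes "finite S" "S \<noteq> {}"
  shows "(\<Sum>A\<in>Pow S - {{}}. (-1) ^ Suc (card A)) = (1 :: 'a :: comm_ring_1)"
proof -
  have "0 = (\<Sum>k\<le>card S. (-1) ^ k * of_nat (card S choose k) :: 'a)"
    using assms by (intro choose_alternating_sum[symmetric]) (simp add: card_gt_0_iff)
  also have "\<dots> = 1 + (\<Sum>k=1..card S. (-1) ^ k * of_nat (card S choose k))"
    by (simp add: atMost_atLeast0 sum.atLeast_Suc_atMost)
  finally have "1 + (\<Sum>k=1..card S. (-1) ^ k * of_nat (card S choose k) :: 'a) = 0" by simp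
  then show ?thesis
    unfolding sum_nonempty_subsets_card[OF assms(1), of "\<lambda>k. (-1) ^ Suc k"]
    by (simp add: sum_negf mult.commute eq_neg_iff_add_eq_0[symmetric])
qed

text \<open>\<open>fps_X\<close> stands for t. The polynomial is kept as a power series so that it
  can be compared with a coefficient of the inverse of \<open>face_denominator\<close>.\<close>

definition face_poly :: "nat set \<Rightarrow> nat set \<Rightarrow> real fps" where
  "face_poly I J = (\<Sum>s\<in>sign_vectors I J. fps_X ^ face_dim I J s)"

text \<open>Exchanging the two families turns \<open>x i - y j\<close> into its negative, whence the
  minus sign; low columns become low rows.\<close>

definition transpose_signs :: "(nat \<Rightarrow> nat \<Rightarrow> real) \<Rightarrow> nat \<Rightarrow> nat \<Rightarrow> real" where
  "transpose_signs s = (\<lambda>j i. - s i j)"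

lemma transpose_sign_vector: "transpose_signs (sign_vector I J x y) = sign_vector J I y x"
  by (intro ext) (simp add: transpose_signs_def sign_vector_def flip: sgn_minus)

lemma bij_betw_transpose_signs: "bij_betw transpose_signs (sign_vectors I J) (sign_vectors J I)"
  by (rule bij_betw_byWitness[where f' = transpose_signs])
    (auto simp: transpose_sign_vector elim!: sign_vectorsE)

lemma face_dim_transpose_signs:
  assumes "s \<in> sign_vectors I J"
  shows "face_dim J I (transpose_signs s) = face_dim I J s"
  using assms
  by (auto simp: transpose_sign_vector face_dim_sign_vector Int_commute elim!: sign_vectorsE)

lemma low_rows_transpose_signs: "low_rows J I (transpose_signs s) = low_columns I J s"
  by (simp add: low_rows_def low_columns_def transpose_signs_def)

lemma face_poly_commute: "face_poly I J = face_poly J I"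
proof -
  have "face_poly J I = (\<Sum>s\<in>sign_vectors I J. fps_X ^ face_dim J I (transpose_signs s))"
    unfolding face_poly_def by (rule sum.reindex_bij_betw[OF bij_betw_transpose_signs, symmetric])
  also have "\<dots> = face_poly I J"
    unfolding face_poly_def by (intro sum.cong) (simp_all add: face_dim_transpose_signs)
  finally show ?thesis by simp
qed

text \<open>The existence of a low row is written as the signed sum over the nonempty sets
  \<open>A\<close> of low rows. After exchanging sums, requiring \<open>A\<close> to be low leaves
  the other rows unrestricted, which yields a full \<open>face_poly\<close>.\<close>

lemma sum_low_rows:
  assumes fin: "finite I" "finite J"
  shows "(\<Sum>s\<in>{s \<in> sign_vectors I J. low_rows I J s \<noteq> {}}. fps_X ^ face_dim I J s) =
    (\<Sum>A\<in>Pow I - {{}}. (-1) ^ Suc (card A) * fps_X ^ card A * face_poly (I - A) J)"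
proof -
  let ?S = "sign_vectors I J" and ?e = "\<lambda>A :: nat set. (-1) ^ Suc (card A) :: real fps"
  have finS: "finite ?S" using fin by (rule finite_sign_vectors)
  have "(\<Sum>s\<in>{s \<in> ?S. low_rows I J s \<noteq> {}}. fps_X ^ face_dim I J s) =
      (\<Sum>s\<in>?S. if low_rows I J s \<noteq> {} then fps_X ^ face_dim I J s else 0)"
    using finS by (rule sum.inter_filter)
  also have "\<dots> = (\<Sum>s\<in>?S. \<Sum>A\<in>{A \<in> Pow I - {{}}. A \<subseteq> low_rows I J s}. ?e A * fps_X ^ face_dim I J s)"
  proof (rule sum.cong)
    fix s
    have eq: "{A \<in> Pow I - {{}}. A \<subseteq> low_rows I J s} = Pow (low_rows I J s) - {{}}"
      by (auto simp: low_rows_def)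
    have "finite (low_rows I J s)" using fin by (simp add: low_rows_def)
    then show "(if low_rows I J s \<noteq> {} then fps_X ^ face_dim I J s else 0) =
      (\<Sum>A\<in>{A \<in> Pow I - {{}}. A \<subseteq> low_rows I J s}. ?e A * fps_X ^ face_dim I J s)"
      unfolding eq sum_distrib_right[symmetric]
      by (cases "low_rows I J s = {}")
        (simp_all only: sum_nonempty_subsets_alternating if_True if_False not_False_eq_True mult_1,
          simp)
  qed simp
  also have "\<dots> = (\<Sum>A\<in>Pow I - {{}}. \<Sum>s\<in>{s \<in> ?S. A \<subseteq> low_rows I J s}. ?e A * fps_X ^ face_dim I J s)"
    using finS fin by (intro sum.swap_restrict) auto
  also have "\<dots> = (\<Sum>A\<in>Pow I - {{}}. ?e A * fps_X ^ card A * face_poly (I - A) J)"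
  proof (rule sum.cong)
    fix A assume "A \<in> Pow I - {{}}"
    then have A: "A \<subseteq> I" by blast
    have "(\<Sum>s\<in>{s \<in> ?S. A \<subseteq> low_rows I J s}. ?e A * fps_X ^ face_dim I J s) =
        (\<Sum>s\<in>{s \<in> ?S. A \<subseteq> low_rows I J s}.
          ?e A * fps_X ^ card A * fps_X ^ face_dim (I - A) J (restrict_signs (I - A) J s))"
      using fin by (intro sum.cong) (simp_all add: face_dim_remove_low_rows[of _ I J A] power_add)
    also have "\<dots> = (\<Sum>s\<in>sign_vectors (I - A) J. ?e A * fps_X ^ card A * fps_X ^ face_dim (I - A) J s)"
      by (rule sum.reindex_bij_betw[OF bij_betw_remove_low_rows[OF A fin(2)]])
    finally show "(\<Sum>s\<in>{s \<in> ?S. A \<subseteq> low_rows I J s}. ?e A * fps_X ^ face_dim I J s) =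
        ?e A * fps_X ^ card A * face_poly (I - A) J"
      by (simp only: face_poly_def sum_distrib_left)
  qed simp
  finally show ?thesis .
qed

lemma sum_low_columns:
  assumes fin: "finite I" "finite J"
  shows "(\<Sum>s\<in>{s \<in> sign_vectors I J. low_columns I J s \<noteq> {}}. fps_X ^ face_dim I J s) =
    (\<Sum>B\<in>Pow J - {{}}. (-1) ^ Suc (card B) * fps_X ^ card B * face_poly I (J - B))"
proof -
  have "bij_betw transpose_signs {s \<in> sign_vectors I J. low_columns I J s \<noteq> {}}
      {s \<in> sign_vectors J I. low_rows J I s \<noteq> {}}"
    using bij_betw_Collect[OF bij_betw_transpose_signs[of I J],
        of "\<lambda>s. low_rows J I s \<noteq> {}" "\<lambda>s. low_columns I J s \<noteq> {}"]
    by (simp add: low_rows_transpose_signs)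
  then have "(\<Sum>s\<in>{s \<in> sign_vectors J I. low_rows J I s \<noteq> {}}. fps_X ^ face_dim J I s) =
      (\<Sum>s\<in>{s \<in> sign_vectors I J. low_columns I J s \<noteq> {}}. fps_X ^ face_dim J I (transpose_signs s))"
    by (rule sum.reindex_bij_betw[symmetric])
  also have "\<dots> = (\<Sum>s\<in>{s \<in> sign_vectors I J. low_columns I J s \<noteq> {}}. fps_X ^ face_dim I J s :: real fps)"
    by (intro sum.cong) (simp_all add: face_dim_transpose_signs)
  finally show ?thesis
    using sum_low_rows[OF fin(2,1)] by (simp add: face_poly_commute[of I])
qed

text \<open>The bottom block is unique, so the pairs \<open>(C, D)\<close> partition these sign
  vectors and no alternating signs occur. The factor \<open>fps_X\<close> is the one dimension lost
  with the block.\<close>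

lemma sum_bottom_blocks:
  assumes fin: "finite I" "finite J" and ne: "I \<noteq> {} \<or> J \<noteq> {}"
  shows "(\<Sum>s\<in>{s \<in> sign_vectors I J. low_rows I J s = {} \<and> low_columns I J s = {}}.
      fps_X ^ face_dim I J s) =
    fps_X * (\<Sum>C\<in>Pow I - {{}}. \<Sum>D\<in>Pow J - {{}}. face_poly (I - C) (J - D))"
proof -
  let ?S = "sign_vectors I J"
  let ?T = "(Pow I - {{}}) \<times> (Pow J - {{}})"
  let ?M = "\<lambda>(C, D). {s \<in> ?S. bottom_block I J C D s}"
  have finS: "finite ?S" using fin by (rule finite_sign_vectors)
  have "{s \<in> ?S. low_rows I J s = {} \<and> low_columns I J s = {}} = (\<Union>t\<in>?T. ?M t)"
    using bottom_block_iff_no_low[OF _ fin ne] by fastforce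
  then have "(\<Sum>s\<in>{s \<in> ?S. low_rows I J s = {} \<and> low_columns I J s = {}}. fps_X ^ face_dim I J s) =
      (\<Sum>s\<in>(\<Union>t\<in>?T. ?M t). fps_X ^ face_dim I J s)"
    by simp
  also have "\<dots> = (\<Sum>t\<in>?T. \<Sum>s\<in>?M t. fps_X ^ face_dim I J s)"
  proof (rule sum.UNION_disjoint)
    show "\<forall>t\<in>?T. \<forall>t'\<in>?T. t \<noteq> t' \<longrightarrow> ?M t \<inter> ?M t' = {}"
    proof (intro ballI impI, rule ccontr)
      fix t t' assume t: "t \<in> ?T" "t' \<in> ?T" "t \<noteq> t'" "?M t \<inter> ?M t' \<noteq> {}"
      obtain C D C' D' where [simp]: "t = (C, D)" "t' = (C', D')" by fastforce
      obtain s where "bottom_block I J C D s" "bottom_block I J C' D' s" using t(4) by auto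
      then have "C = C'" "D = D'"
        using t(1,2) bottom_block_unique[of I J C D s] bottom_block_unique[of I J C' D' s] by simp_all
      then show False using t(3) by simp
    qed
  qed (use fin finS in auto)
  also have "\<dots> = (\<Sum>(C, D)\<in>?T. fps_X * face_poly (I - C) (J - D))"
  proof (rule sum.cong)
    fix t assume "t \<in> ?T"
    then obtain C D where t: "t = (C, D)" and CD: "C \<subseteq> I" "D \<subseteq> J" "C \<noteq> {}" "D \<noteq> {}"
      by blast
    have "(\<Sum>s\<in>{s \<in> ?S. bottom_block I J C D s}. fps_X ^ face_dim I J s) =
        (\<Sum>s\<in>{s \<in> ?S. bottom_block I J C D s}.
          fps_X * fps_X ^ face_dim (I - C) (J - D) (restrict_signs (I - C) (J - D) s))"
      using CD fin by (intro sum.cong) (simp_all add: face_dim_remove_bottom_block[of _ I J C D])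
    also have "\<dots> = (\<Sum>s\<in>sign_vectors (I - C) (J - D). fps_X * fps_X ^ face_dim (I - C) (J - D) s)"
      by (rule sum.reindex_bij_betw[OF bij_betw_remove_bottom_block[OF CD(1,2) fin]])
    finally show "(\<Sum>s\<in>?M t. fps_X ^ face_dim I J s) =
        (case t of (C, D) \<Rightarrow> fps_X * face_poly (I - C) (J - D))"
      by (simp only: t prod.case face_poly_def sum_distrib_left)
  qed simp
  also have "\<dots> = fps_X * (\<Sum>C\<in>Pow I - {{}}. \<Sum>D\<in>Pow J - {{}}. face_poly (I - C) (J - D))"
    by (simp add: sum.cartesian_product sum_distrib_left split_def)
  finally show ?thesis .
qed

text \<open>A low row and a low column would disagree where they cross, so the three kinds of bottom
  exclude each other and their sums add up.\<close>

lemma face_poly_recurrence: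
  assumes fin: "finite I" "finite J" and ne: "I \<noteq> {} \<or> J \<noteq> {}"
  shows "face_poly I J =
    (\<Sum>A\<in>Pow I - {{}}. (-1) ^ Suc (card A) * fps_X ^ card A * face_poly (I - A) J)
    + (\<Sum>B\<in>Pow J - {{}}. (-1) ^ Suc (card B) * fps_X ^ card B * face_poly I (J - B))
    + fps_X * (\<Sum>C\<in>Pow I - {{}}. \<Sum>D\<in>Pow J - {{}}. face_poly (I - C) (J - D))"
proof -
  let ?S = "sign_vectors I J"
  let ?P = "{s \<in> ?S. low_rows I J s \<noteq> {}}" and ?Q = "{s \<in> ?S. low_columns I J s \<noteq> {}}"
    and ?R = "{s \<in> ?S. low_rows I J s = {} \<and> low_columns I J s = {}}"
  have finS: "finite ?S" using fin by (rule finite_sign_vectors)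
  have "?S = (?P \<union> ?Q) \<union> ?R" by blast
  then have "face_poly I J = (\<Sum>s\<in>(?P \<union> ?Q) \<union> ?R. fps_X ^ face_dim I J s)"
    by (simp add: face_poly_def)
  also have "\<dots> = (\<Sum>s\<in>?P \<union> ?Q. fps_X ^ face_dim I J s) + (\<Sum>s\<in>?R. fps_X ^ face_dim I J s)"
    using finS by (intro sum.union_disjoint) auto
  also have "(\<Sum>s\<in>?P \<union> ?Q. fps_X ^ face_dim I J s :: real fps) =
      (\<Sum>s\<in>?P. fps_X ^ face_dim I J s) + (\<Sum>s\<in>?Q. fps_X ^ face_dim I J s)"
  proof (rule sum.union_disjoint)
    show "?P \<inter> ?Q = {}" using low_rows_low_columns_disjoint by blast
  qed (use finS in simp_all)
  finally show ?thesis
    unfolding sum_low_rows[OF fin] sum_low_columns[OF fin] sum_bottom_blocks[OF fin ne] .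
qed

section \<open>Matching the face recurrence with the series recurrence\<close>

lemma binomial_fact_neg_exp_coeff:
  assumes "k \<le> m"
  shows "of_nat (m choose k) * ((-1) ^ Suc k * fps_X ^ k * fps_const (fact (m - k) * r)) =
    - (fps_const (fact m * r) * neg_exp_coeff k)"
proof -
  have "(-1 :: real fps) ^ Suc k = fps_const ((-1) ^ Suc k)"
  proof -
    have "(-1 :: real fps) = fps_const (-1)" by (simp flip: fps_const_neg)
    then show ?thesis by (simp only: fps_const_power)
  qed
  \<comment> \<open>The binomial coefficient times (m - k)! is m!/k!, and 1/k! supplies the
    exponential coefficient; \<open>r\<close> is a place for the factorial of the other index
    set.\<close>
  moreover have "real (m choose k) * ((-1) ^ Suc k * (fact (m - k) * r)) = - (fact m * r * ((-1) ^ k / fact k))"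
    using assms by (simp add: binomial_fact field_simps)
  ultimately show ?thesis
    by (simp add: neg_exp_coeff_def fps_of_nat[symmetric] mult_ac
        fps_const_neg[symmetric] del: fps_const_neg)
qed

text \<open>Both sides satisfy the same recurrence once the factorials turn sums over subsets into
  sums over sizes, so induction on the total number of indices applies.\<close>

lemma face_poly_eq_inverse_face_denominator:
  assumes "finite I" "finite J"
  shows "face_poly I J =
    fps_const (fact (card I) * fact (card J)) * (1 / face_denominator) $ card J $ card I"
  using assms
proof (induction "card I + card J" arbitrary: I J rule: less_induct)
  case less
  note fin = less.prems
  let ?c = "\<lambda>n m. (1 / face_denominator) $ n $ m"
  let ?K = "\<lambda>m n. fps_const (fact m * fact n) :: real fps"
  show ?case
  proof (cases "I = {} \<and> J = {}")
    case True
    \<comment> \<open>With no indices, the only sign vector has dimension 0, so both sides are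
      1.\<close>
    have "sign_vectors {} {} = {\<lambda>_ _. 0}" by (auto simp: sign_vectors_def sign_vector_def)
    then show ?thesis
      using True inverse_face_denominator_recurrence(1) by (simp add: face_poly_def face_dim_def)
  next
    case False
    define m n where "m = card I" and "n = card J"
    have pos: "m + n > 0" using False fin by (auto simp: m_def n_def card_gt_0_iff)
    have sub: "A \<subseteq> I \<and> finite A \<and> card A \<le> m \<and> card (I - A) = m - card A \<and> (card A = 0 \<longleftrightarrow> A = {})"
      if "A \<in> Pow I" for A
      using that fin finite_subset[of A I] by (auto simp: m_def card_Diff_subset card_mono)
    have sub': "B \<subseteq> J \<and> finite B \<and> card B \<le> n \<and> card (J - B) = n - card B \<and> (card B = 0 \<longleftrightarrow> B = {})"
      if "B \<in> Pow J" for B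
      using that fin finite_subset[of B J] by (auto simp: n_def card_Diff_subset card_mono)
    have IH: "face_poly (I - A) (J - B) = ?K (m - card A) (n - card B) * ?c (n - card B) (m - card A)"
      if "A \<in> Pow I" "B \<in> Pow J" "A \<noteq> {} \<or> B \<noteq> {}" for A B
    proof -
      have "card (I - A) + card (J - B) < card I + card J"
        using sub[OF that(1)] sub'[OF that(2)] that(3) unfolding m_def[symmetric] n_def[symmetric]
        by auto
      from less.hyps[OF this] show ?thesis
        using fin sub[OF that(1)] sub'[OF that(2)] by simp
    qed
    have "(\<Sum>A\<in>Pow I - {{}}. (-1) ^ Suc (card A) * fps_X ^ card A * face_poly (I - A) J) =
        (\<Sum>A\<in>Pow I - {{}}. (-1) ^ Suc (card A) * fps_X ^ card A * ?K (m - card A) n * ?c n (m - card A))"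
      using IH[of _ "{}"] by (intro sum.cong) (simp_all add: mult.assoc)
    \<comment> \<open>The summand depends on \<open>A\<close> only through its size, so subsets are
      grouped by cardinality.\<close>
    also have "\<dots> = (\<Sum>k=1..m. of_nat (m choose k) *
        ((-1) ^ Suc k * fps_X ^ k * ?K (m - k) n * ?c n (m - k)))"
      unfolding m_def by (rule sum_nonempty_subsets_card[OF fin(1)])
    also have "\<dots> = (\<Sum>k=1..m. - (?K m n * (neg_exp_coeff k * ?c n (m - k))))"
    proof (rule sum.cong)
      fix k assume "k \<in> {1..m}"
      then show "of_nat (m choose k) * ((-1) ^ Suc k * fps_X ^ k * ?K (m - k) n * ?c n (m - k)) =
          - (?K m n * (neg_exp_coeff k * ?c n (m - k)))"
        using arg_cong[OF binomial_fact_neg_exp_coeff[of k m "fact n"], of "\<lambda>z. z * ?c n (m - k)"]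
        by (simp only: atLeastAtMost_iff mult.assoc minus_mult_left)
    qed simp
    also have "\<dots> = - (?K m n * (\<Sum>k=1..m. neg_exp_coeff k * ?c n (m - k)))"
      by (simp only: sum_negf sum_distrib_left)
    finally have rows: "(\<Sum>A\<in>Pow I - {{}}. (-1) ^ Suc (card A) * fps_X ^ card A * face_poly (I - A) J) =
      - (?K m n * (\<Sum>k=1..m. neg_exp_coeff k * ?c n (m - k)))" .
    have "(\<Sum>B\<in>Pow J - {{}}. (-1) ^ Suc (card B) * fps_X ^ card B * face_poly I (J - B)) =
        (\<Sum>B\<in>Pow J - {{}}. (-1) ^ Suc (card B) * fps_X ^ card B * ?K m (n - card B) * ?c (n - card B) m)"
      using IH[of "{}"] by (intro sum.cong) (simp_all add: mult.assoc)
    also have "\<dots> = (\<Sum>k=1..n. of_nat (n choose k) *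
        ((-1) ^ Suc k * fps_X ^ k * ?K m (n - k) * ?c (n - k) m))"
      unfolding n_def by (rule sum_nonempty_subsets_card[OF fin(2)])
    also have "\<dots> = (\<Sum>k=1..n. - (?K m n * (neg_exp_coeff k * ?c (n - k) m)))"
    proof (rule sum.cong)
      fix k assume "k \<in> {1..n}"
      then show "of_nat (n choose k) * ((-1) ^ Suc k * fps_X ^ k * ?K m (n - k) * ?c (n - k) m) =
          - (?K m n * (neg_exp_coeff k * ?c (n - k) m))"
        using arg_cong[OF binomial_fact_neg_exp_coeff[of k n "fact m"], of "\<lambda>z. z * ?c (n - k) m"]
        by (simp only: atLeastAtMost_iff mult.assoc minus_mult_left mult.commute[of "fact m :: real"])
    qed simp
    also have "\<dots> = - (?K m n * (\<Sum>k=1..n. neg_exp_coeff k * ?c (n - k) m))"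
      by (simp only: sum_negf sum_distrib_left)
    finally have columns: "(\<Sum>B\<in>Pow J - {{}}. (-1) ^ Suc (card B) * fps_X ^ card B * face_poly I (J - B)) =
      - (?K m n * (\<Sum>k=1..n. neg_exp_coeff k * ?c (n - k) m))" .
    have "(\<Sum>C\<in>Pow I - {{}}. \<Sum>D\<in>Pow J - {{}}. face_poly (I - C) (J - D)) =
        (\<Sum>C\<in>Pow I - {{}}. \<Sum>D\<in>Pow J - {{}}.
          ?K (m - card C) (n - card D) * ?c (n - card D) (m - card C))"
      using IH by (intro sum.cong) simp_all
    \<comment> \<open>The double sum over subsets is collapsed one factor at a time, first over
      \<open>D\<close> with \<open>C\<close> fixed.\<close>
    also have "\<dots> = (\<Sum>C\<in>Pow I - {{}}. \<Sum>l=1..n. of_nat (n choose l) *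
          (?K (m - card C) (n - l) * ?c (n - l) (m - card C)))"
      unfolding n_def by (intro sum.cong refl sum_nonempty_subsets_card[OF fin(2)])
    also have "\<dots> = (\<Sum>k=1..m. of_nat (m choose k) * (\<Sum>l=1..n. of_nat (n choose l) *
          (?K (m - k) (n - l) * ?c (n - l) (m - k))))"
      unfolding m_def by (rule sum_nonempty_subsets_card[OF fin(1)])
    also have "\<dots> = (\<Sum>k=1..m. \<Sum>l=1..n.
        ?K m n * (fps_const (1 / (fact k * fact l)) * ?c (n - l) (m - k)))"
      unfolding sum_distrib_left
    proof (intro sum.cong refl)
      fix k l assume "k \<in> {1..m}" "l \<in> {1..n}"
      then have "real (m choose k) * (real (n choose l) * (fact (m - k) * fact (n - l))) =
          fact m * fact n * (1 / (fact k * fact l))"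
        by (simp add: binomial_fact field_simps)
      then have "of_nat (m choose k) * (of_nat (n choose l) * ?K (m - k) (n - l)) =
          ?K m n * fps_const (1 / (fact k * fact l))"
        by (simp only: fps_of_nat[symmetric] fps_const_mult)
      from arg_cong[OF this, of "\<lambda>z. z * ?c (n - l) (m - k)"]
      show "of_nat (m choose k) * (of_nat (n choose l) * (?K (m - k) (n - l) * ?c (n - l) (m - k))) =
        ?K m n * (fps_const (1 / (fact k * fact l)) * ?c (n - l) (m - k))"
        by (simp only: mult.assoc)
    qed
    also have "\<dots> = ?K m n * (\<Sum>k=1..m. \<Sum>l=1..n.
        fps_const (1 / (fact k * fact l)) * ?c (n - l) (m - k))"
      by (simp only: sum_distrib_left)
    finally have blocks: "(\<Sum>C\<in>Pow I - {{}}. \<Sum>D\<in>Pow J - {{}}. face_poly (I - C) (J - D)) =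
      ?K m n * (\<Sum>k=1..m. \<Sum>l=1..n. fps_const (1 / (fact k * fact l)) * ?c (n - l) (m - k))" .
    have factor: "- (K * a) + - (K * b) + fps_X * (K * c) = K * (- a - b + fps_X * c)"
      for K a b c :: "real fps"
      by (simp add: algebra_simps)
    have ne: "I \<noteq> {} \<or> J \<noteq> {}" using False by blast
    have "face_poly I J = ?K m n * ?c n m"
      unfolding face_poly_recurrence[OF fin ne] rows columns blocks factor
        inverse_face_denominator_recurrence(2)[OF pos] ..
    then show ?thesis by (simp add: m_def n_def)
  qed
qed

lemma face_poly_nth:
  assumes "finite I" "finite J"
  shows "face_poly I J $ k = card {s \<in> sign_vectors I J. face_dim I J s = k}"
proof -
  have "face_poly I J $ k = (\<Sum>s\<in>sign_vectors I J. if face_dim I J s = k then 1 else 0)"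
    unfolding face_poly_def fps_sum_nth by (intro sum.cong) (auto simp: fps_X_power_nth)
  also have "\<dots> = card {s \<in> sign_vectors I J. face_dim I J s = k}"
    using finite_sign_vectors[OF assms] by (simp add: sum.inter_filter[symmetric])
  finally show ?thesis .
qed

theorem proposition1:
  shows "series3 (\<lambda>k m n. real (num_faces k m n) / (fact m * fact n)) =
    1 / (exp3 (- (var_t * var_x)) + exp3 (- (var_t * var_y))
         - var_t * (exp3 var_x - 1) * (exp3 var_y - 1) - 1)"
proof -
  have "series3 (\<lambda>k m n. real (num_faces k m n) / (fact m * fact n)) = 1 / face_denominator"
  proof (intro fps_ext)
    fix n m k
    have "real (num_faces k m n) = face_poly {1..m} {1..n} $ k"
      by (simp add: num_faces_eq face_poly_nth)
    also have "\<dots> = fact m * fact n * (1 / face_denominator) $ n $ m $ k"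
      by (simp add: face_poly_eq_inverse_face_denominator)
    finally show "series3 (\<lambda>k m n. real (num_faces k m n) / (fact m * fact n)) $ n $ m $ k =
        (1 / face_denominator) $ n $ m $ k"
      by (simp add: series3_def)
  qed
  then show ?thesis by (simp only: face_denominator_def)
qed

end
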